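(* For every real $w>0$ and every integer $n\geq 2$, $$\inf\left\{V_{\mathbb{H}^n}(K)\colon K\subset \mathbb{H}^n\text{ is a convex body with } w(K)\geq w\right\}=0,$$ where $w(K)$ is the minimal Lassak width of $K$.
   Context: $\mathbb{H}^n$ is $n$-dimensional hyperbolic space of constant curvature $-1$ with geodesic distance $d$, and $V_{\mathbb{H}^n}$ is the hyperbolic volume. A convex body is a compact, (geodesically) convex set with non-empty interior. A hyperplane $H\subset\mathbb{H}^n$ is a supporting hyperplane of a convex body $K$ if $H\cap K\neq\emptyset$ and $K$ lies in one of the two closed half-spaces bounded by $H$. For a supporting hyperplane $H$ of $K$, the Lassak width of $K$ with respect to $H$ is $\max_{x\in K} d(x,H)$. The minimal Lassak width $w(K)$ of $K$ is the minimum of the Lassak widths of $K$ over all supporting hyperplanes of $K$. *)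

theory Defs
  imports "HOL-Analysis.Analysis"
begin

section \<open>The hyperboloid model of hyperbolic space\<close>

text \<open>Minkowski space of signature (n,1) is \<open>(real^'n) \<times> real\<close>, the last component being the
  time coordinate; n is \<open>CARD('n)\<close>.\<close>

definition lorentz :: "(real^'n) \<times> real \<Rightarrow> (real^'n) \<times> real \<Rightarrow> real" where
  "lorentz p q = fst p \<bullet> fst q - snd p * snd q"

lemma lorentz_commute: "lorentz p q = lorentz q p"
  by (simp add: lorentz_def inner_commute)

lemma lorentz_add_left: "lorentz (p + q) r = lorentz p r + lorentz q r"
  by (simp add: lorentz_def inner_add_left algebra_simps)

lemma lorentz_add_right: "lorentz r (p + q) = lorentz r p + lorentz r q"
  by (simp add: lorentz_def inner_add_right algebra_simps)

lemma lorentz_diff_left: "lorentz (p - q) r = lorentz p r - lorentz q r"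
  by (simp add: lorentz_def inner_diff_left algebra_simps)

lemma lorentz_diff_right: "lorentz r (p - q) = lorentz r p - lorentz r q"
  by (simp add: lorentz_def inner_diff_right algebra_simps)

lemma lorentz_scaleR_left: "lorentz (c *\<^sub>R p) r = c * lorentz p r"
  by (simp add: lorentz_def algebra_simps)

lemma lorentz_scaleR_right: "lorentz r (c *\<^sub>R p) = c * lorentz r p"
  by (simp add: lorentz_def algebra_simps)

lemmas lorentz_linear = lorentz_add_left lorentz_add_right lorentz_diff_left lorentz_diff_right
  lorentz_scaleR_left lorentz_scaleR_right

typedef (overloaded) 'n hyp = "{p :: (real^'n) \<times> real. lorentz p p = -1 \<and> snd p > 0}"
  by (rule exI[of _ "(0, 1)"]) (simp add: lorentz_def)

lemma Rep_hyp_lorentz [simp]: "lorentz (Rep_hyp p) (Rep_hyp p) = -1"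
  and Rep_hyp_pos: "snd (Rep_hyp p) > 0"
  using Rep_hyp[of p] by auto

lemma hyp_norm_fst: "(norm (fst (Rep_hyp p)))\<^sup>2 = (snd (Rep_hyp p))\<^sup>2 - 1"
  using Rep_hyp_lorentz[of p]
  by (simp add: lorentz_def dot_square_norm flip: power2_eq_square)

lemma lorentz_orth_bound:
  assumes "lorentz (Rep_hyp y) p = 0"
  shows "(norm (fst p))\<^sup>2 \<le> (snd (Rep_hyp y))\<^sup>2 * lorentz p p"
proof -
  let ?t = "snd (Rep_hyp y)"
  have "?t * snd p = fst (Rep_hyp y) \<bullet> fst p" using assms by (simp add: lorentz_def)
  then have "(?t * snd p)\<^sup>2 \<le> (norm (fst (Rep_hyp y)))\<^sup>2 * (norm (fst p))\<^sup>2"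
    using Cauchy_Schwarz_ineq[of "fst (Rep_hyp y)" "fst p"] by (simp add: power2_norm_eq_inner)
  then have b: "(?t * snd p)\<^sup>2 \<le> (?t\<^sup>2 - 1) * (norm (fst p))\<^sup>2" by (simp add: hyp_norm_fst)
  have l: "lorentz p p = (norm (fst p))\<^sup>2 - (snd p)\<^sup>2"
    by (simp add: lorentz_def dot_square_norm flip: power2_eq_square)
  with b show ?thesis unfolding l by (simp add: algebra_simps power_mult_distrib)
qed

lemma lorentz_orth_nonneg:
  assumes "lorentz (Rep_hyp y) p = 0"
  shows "lorentz p p \<ge> 0"
proof -
  have "0 \<le> (snd (Rep_hyp y))\<^sup>2 * lorentz p p"
    using lorentz_orth_bound[OF assms] order_trans zero_le_power2 by blast
  then show ?thesis using Rep_hyp_pos[of y] by (simp add: zero_le_mult_iff)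
qed

lemma lorentz_orth_zero:
  assumes "lorentz (Rep_hyp y) p = 0" "lorentz p p = 0"
  shows "p = 0"
proof -
  have "fst p = 0" using lorentz_orth_bound[OF assms(1)] assms(2) by simp
  moreover from this have "snd p = 0" using assms(2) by (simp add: lorentz_def)
  ultimately show ?thesis by (simp add: prod_eq_iff)
qed

lemma lorentz_orth_Cauchy_Schwarz:
  assumes "lorentz (Rep_hyp y) u = 0" "lorentz (Rep_hyp y) v = 0"
  shows "(lorentz u v)\<^sup>2 \<le> lorentz u u * lorentz v v"
proof (cases "lorentz v v = 0")
  case True
  then have "v = 0" using lorentz_orth_zero assms(2) by blast
  then show ?thesis by (simp add: lorentz_def)
next
  case False
  then have pos: "lorentz v v > 0" using lorentz_orth_nonneg[OF assms(2)] by simp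
  let ?p = "lorentz v v *\<^sub>R u - lorentz u v *\<^sub>R v"
  have "lorentz (Rep_hyp y) ?p = 0" using assms by (simp add: lorentz_linear)
  then have "0 \<le> lorentz ?p ?p" by (rule lorentz_orth_nonneg)
  also have "lorentz ?p ?p = lorentz v v * (lorentz u u * lorentz v v - (lorentz u v)\<^sup>2)"
    by (simp add: lorentz_linear lorentz_commute[of v u] algebra_simps power2_eq_square)
  finally show ?thesis using pos by (simp add: zero_le_mult_iff)
qed

lemma hyp_lorentz_le: "lorentz (Rep_hyp p) (Rep_hyp q) \<le> -1"
proof -
  let ?a = "fst (Rep_hyp p)" and ?b = "fst (Rep_hyp q)"
  let ?s = "snd (Rep_hyp p)" and ?t = "snd (Rep_hyp q)"
  have st: "?s > 0" "?t > 0" by (rule Rep_hyp_pos)+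
  have a: "?s\<^sup>2 = 1 + (norm ?a)\<^sup>2" and b: "?t\<^sup>2 = 1 + (norm ?b)\<^sup>2" by (simp_all add: hyp_norm_fst)
  have "(1 + norm ?a * norm ?b)\<^sup>2 \<le> (?s * ?t)\<^sup>2"
    using zero_le_power2[of "norm ?a - norm ?b"] unfolding power_mult_distrib a b
    by (simp add: power2_eq_square algebra_simps)
  then have "1 + norm ?a * norm ?b \<le> ?s * ?t"
    using st by (meson less_imp_le mult_nonneg_nonneg power2_le_imp_le)
  moreover have "?a \<bullet> ?b \<le> norm ?a * norm ?b" by (rule norm_cauchy_schwarz)
  ultimately show ?thesis by (simp add: lorentz_def)
qed

lemma hyp_lorentz_eq_iff: "lorentz (Rep_hyp p) (Rep_hyp q) = -1 \<longleftrightarrow> p = q"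
proof
  assume l: "lorentz (Rep_hyp p) (Rep_hyp q) = -1"
  have "lorentz (Rep_hyp p) (Rep_hyp q - Rep_hyp p) = 0" using l by (simp add: lorentz_linear)
  moreover have "lorentz (Rep_hyp q - Rep_hyp p) (Rep_hyp q - Rep_hyp p) = 0"
    using l by (simp add: lorentz_linear lorentz_commute[of "Rep_hyp q" "Rep_hyp p"])
  ultimately have "Rep_hyp q - Rep_hyp p = 0" by (rule lorentz_orth_zero)
  then show "p = q" by (simp add: Rep_hyp_inject)
qed simp

lemma hyp_arcosh_triangle:
  "arcosh (- lorentz (Rep_hyp x) (Rep_hyp z))
     \<le> arcosh (- lorentz (Rep_hyp x) (Rep_hyp y)) + arcosh (- lorentz (Rep_hyp y) (Rep_hyp z))"
proof -
  define a where "a = - lorentz (Rep_hyp x) (Rep_hyp y)"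
  define b where "b = - lorentz (Rep_hyp y) (Rep_hyp z)"
  define c where "c = - lorentz (Rep_hyp x) (Rep_hyp z)"
  have ge1: "a \<ge> 1" "b \<ge> 1" "c \<ge> 1"
    using hyp_lorentz_le[of x y] hyp_lorentz_le[of y z] hyp_lorentz_le[of x z]
    by (simp_all add: a_def b_def c_def)
  have xy: "lorentz (Rep_hyp x) (Rep_hyp y) = - a" "lorentz (Rep_hyp y) (Rep_hyp x) = - a"
    and yz: "lorentz (Rep_hyp y) (Rep_hyp z) = - b" "lorentz (Rep_hyp z) (Rep_hyp y) = - b"
    and xz: "lorentz (Rep_hyp x) (Rep_hyp z) = - c" "lorentz (Rep_hyp z) (Rep_hyp x) = - c"
    by (simp_all add: a_def b_def c_def lorentz_commute)
  define u where "u = Rep_hyp x - a *\<^sub>R Rep_hyp y"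
  define v where "v = Rep_hyp z - b *\<^sub>R Rep_hyp y"
  have "lorentz (Rep_hyp y) u = 0" "lorentz (Rep_hyp y) v = 0"
    by (simp_all add: u_def v_def lorentz_linear xy yz)
  then have cs: "(lorentz u v)\<^sup>2 \<le> lorentz u u * lorentz v v"
    by (rule lorentz_orth_Cauchy_Schwarz)
  have uv: "lorentz u u = a\<^sup>2 - 1" "lorentz v v = b\<^sup>2 - 1" "lorentz u v = a * b - c"
    by (simp_all add: u_def v_def lorentz_linear xy yz xz power2_eq_square)
  have "c - a * b \<le> sqrt ((a\<^sup>2 - 1) * (b\<^sup>2 - 1))"
    using cs unfolding uv by (intro real_le_rsqrt) (simp add: power2_commute)
  then have "c \<le> a * b + sqrt (a\<^sup>2 - 1) * sqrt (b\<^sup>2 - 1)" by (simp add: real_sqrt_mult)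
  also have "\<dots> = cosh (arcosh a + arcosh b)"
    using ge1 by (simp add: cosh_add sinh_arcosh_real)
  finally have "arcosh c \<le> arcosh (cosh (arcosh a + arcosh b))"
    using ge1(3) arcosh_less_iff_real[of "cosh (arcosh a + arcosh b)" c] cosh_real_ge_1
    by (metis linorder_not_less)
  also have "\<dots> = arcosh a + arcosh b" using ge1 by (intro arcosh_cosh_real) simp
  finally show ?thesis unfolding a_def b_def c_def .
qed

instantiation hyp :: (finite) metric_space
begin

definition dist_hyp :: "'a hyp \<Rightarrow> 'a hyp \<Rightarrow> real" where
  "dist_hyp p q = arcosh (- lorentz (Rep_hyp p) (Rep_hyp q))"

definition uniformity_hyp :: "('a hyp \<times> 'a hyp) filter" where
  "uniformity_hyp = (INF e\<in>{0<..}. principal {(x, y). dist x y < e})"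

definition open_hyp :: "'a hyp set \<Rightarrow> bool" where
  "open_hyp U \<longleftrightarrow> (\<forall>x\<in>U. eventually (\<lambda>(x', y). x' = x \<longrightarrow> y \<in> U) uniformity)"

instance
proof
  fix x y z :: "'a hyp"
  have "dist x y = 0 \<longleftrightarrow> lorentz (Rep_hyp x) (Rep_hyp y) = -1"
    using hyp_lorentz_le[of x y] arcosh_eq_0_iff_real[of "- lorentz (Rep_hyp x) (Rep_hyp y)"]
    unfolding dist_hyp_def by linarith
  then show "dist x y = 0 \<longleftrightarrow> x = y" by (simp add: hyp_lorentz_eq_iff)
  show "dist x y \<le> dist x z + dist y z"
    unfolding dist_hyp_def using hyp_arcosh_triangle[of x y z]
    by (simp add: lorentz_commute[of "Rep_hyp z" "Rep_hyp y"])
qed (simp_all add: uniformity_hyp_def open_hyp_def)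

end

section \<open>Hyperbolic volume\<close>

text \<open>The chart of the hyperboloid given by the space-like coordinates. In it the Riemannian metric
  induced by the Lorentz form is \<open>g\<^sub>i\<^sub>j = \<delta>\<^sub>i\<^sub>j - x\<^sub>i x\<^sub>j / (1 + |x|\<^sup>2)\<close>, hence
  \<open>det g = 1 / (1 + |x|\<^sup>2)\<close> and the volume element is \<open>dx / sqrt (1 + |x|\<^sup>2)\<close>.\<close>

definition hyp_chart :: "real^'n \<Rightarrow> 'n hyp" where
  "hyp_chart x = Abs_hyp (x, sqrt (1 + (norm x)\<^sup>2))"

definition hyp_measure :: "'n::finite hyp measure" where
  "hyp_measure =
     distr (density lborel (\<lambda>x. ennreal (1 / sqrt (1 + (norm x)\<^sup>2)))) borel hyp_chart"

definition hyp_volume :: "'n::finite hyp set \<Rightarrow> ennreal" where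
  "hyp_volume K = emeasure hyp_measure K"

lemma Rep_hyp_chart: "Rep_hyp (hyp_chart x) = (x, sqrt (1 + (norm x)\<^sup>2))"
proof -
  have "1 + (norm x)\<^sup>2 > 0" by (simp add: add_pos_nonneg)
  then show ?thesis
    unfolding hyp_chart_def
    by (intro Abs_hyp_inverse) (simp add: lorentz_def power2_norm_eq_inner flip: power2_eq_square)
qed

lemma bij_hyp_chart: "bij (hyp_chart :: real^'a \<Rightarrow> 'a hyp)"
proof (rule bijI)
  show "inj (hyp_chart :: real^'a \<Rightarrow> 'a hyp)" by (metis Rep_hyp_chart injI prod.inject)
  have "hyp_chart (fst (Rep_hyp p)) = p" for p :: "'a hyp"
    using Rep_hyp_pos[of p]
    by (simp add: Rep_hyp_inject[symmetric] Rep_hyp_chart hyp_norm_fst prod_eq_iff)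
  then show "surj (hyp_chart :: real^'a \<Rightarrow> 'a hyp)" unfolding surj_def by metis
qed

lemma continuous_hyp_chart: "continuous_on UNIV (hyp_chart :: real^'n \<Rightarrow> 'n hyp)"
  unfolding continuous_on_def
proof
  fix x :: "real^'n"
  have "((\<lambda>y. - lorentz (Rep_hyp (hyp_chart y)) (Rep_hyp (hyp_chart x)))
      \<longlongrightarrow> - lorentz (Rep_hyp (hyp_chart x)) (Rep_hyp (hyp_chart x))) (at x)"
    unfolding Rep_hyp_chart lorentz_def by (auto intro!: tendsto_eq_intros)
  then have "((\<lambda>y. - lorentz (Rep_hyp (hyp_chart y)) (Rep_hyp (hyp_chart x))) \<longlongrightarrow> 1) (at x)"
    by simp
  moreover have "- lorentz (Rep_hyp p) (Rep_hyp q) \<ge> 1" for p q :: "'n hyp"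
    using hyp_lorentz_le[of p q] by linarith
  ultimately have "((\<lambda>y. dist (hyp_chart y) (hyp_chart x)) \<longlongrightarrow> arcosh 1) (at x)"
    unfolding dist_hyp_def by (intro tendsto_arcosh_strong always_eventually allI) auto
  then show "(hyp_chart \<longlongrightarrow> hyp_chart x) (at x within UNIV)"
    by (simp add: tendsto_dist_iff[of hyp_chart])
qed

lemma hyp_volume_eq:
  fixes K :: "'n::finite hyp set"
  assumes "K \<in> sets borel"
  shows "hyp_volume K =
    (\<integral>\<^sup>+x\<in>hyp_chart -` K. ennreal (1 / sqrt (1 + (norm x)\<^sup>2)) \<partial>lborel)"
proof -
  have m: "hyp_chart \<in> borel_measurable (borel :: (real^'n) measure)"
    by (rule borel_measurable_continuous_onI[OF continuous_hyp_chart])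
  then have "hyp_chart -` K \<in> sets (borel :: (real^'n) measure)"
    using measurable_sets[OF m assms] by simp
  then show ?thesis
    using m assms unfolding hyp_volume_def hyp_measure_def
    by (simp add: emeasure_distr emeasure_density)
qed

section \<open>Convex bodies and the minimal Lassak width\<close>

text \<open>Unit-speed parametrisations of geodesic segments are exactly the isometric embeddings of
  compact intervals.\<close>

definition geodesic_on :: "real \<Rightarrow> (real \<Rightarrow> 'n::finite hyp) \<Rightarrow> bool" where
  "geodesic_on L g \<longleftrightarrow> 0 \<le> L \<and> (\<forall>s\<in>{0..L}. \<forall>t\<in>{0..L}. dist (g s) (g t) = \<bar>s - t\<bar>)"

definition geodesically_convex :: "'n::finite hyp set \<Rightarrow> bool" where
  "geodesically_convex K \<longleftrightarrow>
     (\<forall>L g. geodesic_on L g \<and> g 0 \<in> K \<and> g L \<in> K \<longrightarrow> g ` {0..L} \<subseteq> K)"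

definition convex_body :: "'n::finite hyp set \<Rightarrow> bool" where
  "convex_body K \<longleftrightarrow> compact K \<and> geodesically_convex K \<and> interior K \<noteq> {}"

text \<open>Hyperplanes are the intersections of the hyperboloid with the Lorentz-orthogonal complements
  of space-like vectors \<open>u\<close>. The other closed half-space bounded by \<open>hyperplane_of u\<close>
  is \<open>halfspace_of (- u)\<close>.\<close>

definition hyperplane_of :: "(real^'n) \<times> real \<Rightarrow> 'n::finite hyp set" where
  "hyperplane_of u = {p. lorentz (Rep_hyp p) u = 0}"

definition halfspace_of :: "(real^'n) \<times> real \<Rightarrow> 'n::finite hyp set" where
  "halfspace_of u = {p. lorentz (Rep_hyp p) u \<le> 0}"

definition supporting_hyperplane :: "'n::finite hyp set \<Rightarrow> 'n hyp set \<Rightarrow> bool" where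
  "supporting_hyperplane K H \<longleftrightarrow>
     (\<exists>u. lorentz u u > 0 \<and> H = hyperplane_of u \<and> H \<inter> K \<noteq> {} \<and>
          (K \<subseteq> halfspace_of u \<or> K \<subseteq> halfspace_of (- u)))"

text \<open>For a convex body the supremum and the infimum below are attained.\<close>

definition lassak_width :: "'n::finite hyp set \<Rightarrow> 'n hyp set \<Rightarrow> real" where
  "lassak_width K H = (SUP x\<in>K. infdist x H)"

definition min_lassak_width :: "'n::finite hyp set \<Rightarrow> real" where
  "min_lassak_width K = (INF H\<in>{H. supporting_hyperplane K H}. lassak_width K H)"

end

theory Submission
  imports Defs
begin

text \<open>Small volume is compatible with large width because two geodesics that leave a point at a tiny
  angle diverge exponentially. Take a very long geodesic segment of half-length \<open>L\<close> centred at the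
  origin \<open>o\<close> and fatten it a little around \<open>o\<close>, so that a body \<open>K\<close> results that contains the ball
  of radius \<open>r\<close> about \<open>o\<close> and the two end points \<open>p\<close>, \<open>q\<close> of the segment.

  Let \<open>u\<close> be a unit normal of a supporting hyperplane \<open>H\<close>, so that the Lorentz product of \<open>u\<close> with
  a point \<open>x\<close> is, up to sign, \<open>sinh (d(x, H))\<close>. As \<open>p + q = 2 cosh L o\<close> in Minkowski space, one of
  \<open>p\<close>, \<open>q\<close> satisfies \<open>sinh d \<ge> cosh L sinh (d(o, H)) \<ge> cosh L sinh r\<close>. So every Lassak width is
  at least \<open>w\<close> as soon as \<open>sinh w \<le> cosh L sinh r\<close> (\<open>lassak_width_ge\<close>), and \<open>r\<close> can be taken as
  small as desired, at the price of a large \<open>L\<close>.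

  It remains to choose \<open>K\<close> of small volume uniformly in \<open>L\<close>. In the projective model \<open>K\<close> is the
  double cone \<open>|x'| + \<delta> |x\<^sub>1| \<le> \<delta> tanh L\<close> over a small disc, where \<open>x'\<close> is the part of \<open>x\<close>
  orthogonal to the axis; it contains the ball with \<open>sinh r = \<delta> tanh L / 2\<close>. On the hyperboloid
  this body has thickness at most \<open>2 \<delta> / t\<close> at time coordinate \<open>t\<close>
  (\<open>off_axis_small_in_spindle\<close>), and this decay already makes the volume of the infinitely long
  body finite and of order \<open>\<delta>\<close> (\<open>hyp_volume_spindle\<close>).\<close>

section \<open>Geodesic convexity of cone sections\<close>

text \<open>A geodesic lies in the plane through the Minkowski origin spanned by its end points. The
  equality \<open>d(x,y) + d(y,z) = d(x,z)\<close> is the equality case of Cauchy-Schwarz for the components of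
  \<open>x\<close> and \<open>z\<close> orthogonal to \<open>y\<close>: the difference of the two sides is orthogonal to \<open>y\<close> and null,
  hence zero.\<close>

lemma geodesic_point_combination:
  assumes g: "geodesic_on L g" and s: "s \<in> {0..L}"
  shows "sinh L *\<^sub>R Rep_hyp (g s) = sinh (L - s) *\<^sub>R Rep_hyp (g 0) + sinh s *\<^sub>R Rep_hyp (g L)"
proof -
  have L: "0 \<le> L" and d: "\<And>s t. s \<in> {0..L} \<Longrightarrow> t \<in> {0..L} \<Longrightarrow> dist (g s) (g t) = \<bar>s - t\<bar>"
    using g by (auto simp: geodesic_on_def)
  have lor: "lorentz (Rep_hyp (g a)) (Rep_hyp (g b)) = - cosh (a - b)"
    if "a \<in> {0..L}" "b \<in> {0..L}" for a b
  proof -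
    have "- lorentz (Rep_hyp (g a)) (Rep_hyp (g b)) \<ge> 1"
      using hyp_lorentz_le[of "g a" "g b"] by linarith
    then have "cosh (dist (g a) (g b)) = - lorentz (Rep_hyp (g a)) (Rep_hyp (g b))"
      by (simp add: dist_hyp_def)
    then show ?thesis using d[OF that] by simp
  qed
  define x y z where "x = Rep_hyp (g 0)" and "y = Rep_hyp (g s)" and "z = Rep_hyp (g L)"
  have xy: "lorentz x y = - cosh s" "lorentz y x = - cosh s"
    and yz: "lorentz y z = - cosh (L - s)" "lorentz z y = - cosh (L - s)"
    and xz: "lorentz x z = - cosh L" "lorentz z x = - cosh L"
    and sq: "lorentz x x = -1" "lorentz y y = -1" "lorentz z z = -1"
    using lor[of 0 s] lor[of s 0] lor[of s L] lor[of L s] lor[of 0 L] lor[of L 0] s L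
      cosh_minus[of "L - s"]
    by (simp_all add: x_def y_def z_def)
  have sL: "sinh L = sinh (L - s) * cosh s + cosh (L - s) * sinh s"
    using sinh_add[of "L - s" s] by simp
  have cL: "cosh L = cosh (L - s) * cosh s + sinh (L - s) * sinh s"
    using cosh_add[of "L - s" s] by simp
  define q where "q = sinh (L - s) *\<^sub>R x + sinh s *\<^sub>R z - sinh L *\<^sub>R y"
  have yq: "lorentz y q = 0"
    by (simp add: q_def lorentz_linear xy yz sq sL)
  have "lorentz q q = lorentz (sinh (L - s) *\<^sub>R x + sinh s *\<^sub>R z) q"
    using yq by (subst (1) q_def) (simp add: lorentz_linear)
  also have "\<dots> = (sinh L)\<^sup>2 - (sinh (L - s))\<^sup>2 - (sinh s)\<^sup>2 - 2 * sinh (L - s) * sinh s * cosh L"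
    by (simp add: q_def lorentz_linear xy yz xz sq sL power2_eq_square algebra_simps)
  also have "\<dots> = (sinh (L - s))\<^sup>2 * ((cosh s)\<^sup>2 - 1 - (sinh s)\<^sup>2)
      + (sinh s)\<^sup>2 * ((cosh (L - s))\<^sup>2 - 1 - (sinh (L - s))\<^sup>2)"
    unfolding sL cL by (simp add: power2_eq_square algebra_simps)
  also have "\<dots> = 0" by (simp add: cosh_square_eq)
  finally have "q = 0" using lorentz_orth_zero[of "g s" q] yq by (simp add: y_def)
  then show ?thesis by (simp add: q_def x_def y_def z_def)
qed

text \<open>The coefficients of the end points in the preceding identity are nonnegative, so a convex
  cone containing the end points contains the whole segment.\<close>

lemma geodesically_convex_cone_section:
  fixes C :: "((real^'n::finite) \<times> real) set"
  assumes "convex C" "cone C"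
  shows "geodesically_convex {p. Rep_hyp p \<in> C}"
  unfolding geodesically_convex_def
proof (intro allI impI, elim conjE)
  fix L and g :: "real \<Rightarrow> 'n hyp"
  assume g: "geodesic_on L g" and ends: "g 0 \<in> {p. Rep_hyp p \<in> C}" "g L \<in> {p. Rep_hyp p \<in> C}"
  show "g ` {0..L} \<subseteq> {p. Rep_hyp p \<in> C}"
  proof clarify
    fix s assume s: "s \<in> {0..L}"
    show "Rep_hyp (g s) \<in> C"
    proof (cases "L = 0")
      case True
      then show ?thesis using s ends by simp
    next
      case False
      then have L: "sinh L > 0" using s by simp
      have "sinh (L - s) *\<^sub>R Rep_hyp (g 0) + sinh s *\<^sub>R Rep_hyp (g L) \<in> C"
        using ends s convex_cone[of C] assms by (simp add: cone_def)
      then have "(1 / sinh L) *\<^sub>R (sinh L *\<^sub>R Rep_hyp (g s)) \<in> C"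
        using geodesic_point_combination[OF g s] L assms(2)
        by (metis cone_def less_imp_le zero_le_divide_1_iff)
      then show ?thesis using L by simp
    qed
  qed
qed

section \<open>Distances to a supporting hyperplane\<close>

text \<open>Cauchy-Schwarz for \<open>u\<close> and the component of \<open>p\<close> orthogonal to \<open>z\<close>, whose Lorentz square is
  \<open>sinh\<^sup>2 (dist p z)\<close>.\<close>

lemma sinh_dist_hyperplane:
  assumes "z \<in> hyperplane_of u"
  shows "(lorentz (Rep_hyp p) u)\<^sup>2 \<le> lorentz u u * (sinh (dist p z))\<^sup>2"
proof -
  define c where "c = - lorentz (Rep_hyp p) (Rep_hyp z)"
  have c1: "c \<ge> 1" using hyp_lorentz_le[of p z] by (simp add: c_def)
  have c: "lorentz (Rep_hyp p) (Rep_hyp z) = - c" "lorentz (Rep_hyp z) (Rep_hyp p) = - c"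
    by (simp_all add: c_def lorentz_commute)
  have zu: "lorentz (Rep_hyp z) u = 0" "lorentz u (Rep_hyp z) = 0"
    using assms by (simp_all add: hyperplane_of_def lorentz_commute)
  have "(lorentz u (Rep_hyp p - c *\<^sub>R Rep_hyp z))\<^sup>2 \<le>
      lorentz u u * lorentz (Rep_hyp p - c *\<^sub>R Rep_hyp z) (Rep_hyp p - c *\<^sub>R Rep_hyp z)"
    by (rule lorentz_orth_Cauchy_Schwarz[of z]) (simp_all add: lorentz_linear zu c)
  moreover have "lorentz (Rep_hyp p - c *\<^sub>R Rep_hyp z) (Rep_hyp p - c *\<^sub>R Rep_hyp z)
      = (sinh (dist p z))\<^sup>2"
  proof -
    have "lorentz (Rep_hyp p - c *\<^sub>R Rep_hyp z) (Rep_hyp p - c *\<^sub>R Rep_hyp z) = c\<^sup>2 - 1"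
      by (simp add: lorentz_linear c power2_eq_square)
    moreover have "sinh (dist p z) = sqrt (c\<^sup>2 - 1)"
      using c1 by (simp add: dist_hyp_def c sinh_arcosh_real)
    moreover have "c\<^sup>2 - 1 \<ge> 0" using c1 by simp
    ultimately show ?thesis by simp
  qed
  ultimately show ?thesis
    by (simp add: lorentz_linear zu lorentz_commute[of u "Rep_hyp p"])
qed

lemma infdist_hyperplane_ge:
  assumes u: "lorentz u u > 0" and ne: "hyperplane_of u \<noteq> {}"
    and le: "(sinh w)\<^sup>2 * lorentz u u \<le> (lorentz (Rep_hyp p) u)\<^sup>2"
  shows "w \<le> infdist p (hyperplane_of u)"
proof -
  have "w \<le> dist p z" if "z \<in> hyperplane_of u" for z
  proof -
    have "(sinh w)\<^sup>2 \<le> (sinh (dist p z))\<^sup>2"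
      using order_trans[OF le sinh_dist_hyperplane[OF that]] u by (simp add: mult.commute)
    then have "sinh w \<le> sinh (dist p z)" by (rule power2_le_imp_le) simp
    then show ?thesis by simp
  qed
  then show ?thesis using ne by (simp add: infdist_def cINF_greatest)
qed

lemma Rep_hyp_chart_polar:
  fixes e :: "real^'n::finite"
  assumes "norm e = 1"
  shows "Rep_hyp (hyp_chart (sinh L *\<^sub>R e)) = (sinh L *\<^sub>R e, cosh L)"
proof -
  have "1 + (norm (sinh L *\<^sub>R e))\<^sup>2 = (cosh L)\<^sup>2"
    using assms by (simp add: power_mult_distrib cosh_square_eq)
  then show ?thesis by (simp add: Rep_hyp_chart)
qed

text \<open>As \<open>snd u\<close> is minus the Lorentz product of \<open>u\<close> with the origin, this says that a half-space
  containing the ball of radius \<open>r\<close> about the origin, \<open>sinh r = \<rho>\<close>, has its boundary at distance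
  at least \<open>r\<close> from the origin. The extremal point of the ball is the one in the direction of the
  space part of \<open>u\<close>.\<close>

lemma normal_of_ball:
  fixes u :: "(real^'n::finite) \<times> real"
  assumes u: "lorentz u u > 0" and sub: "hyp_chart ` cball 0 \<rho> \<subseteq> halfspace_of u" and \<rho>: "\<rho> \<ge> 0"
  shows "snd u \<ge> 0 \<and> \<rho>\<^sup>2 * lorentz u u \<le> (snd u)\<^sup>2"
proof -
  let ?a = "fst u" and ?s = "snd u"
  have uu: "lorentz u u = (norm ?a)\<^sup>2 - ?s\<^sup>2"
    by (simp add: lorentz_def dot_square_norm flip: power2_eq_square)
  then have a: "norm ?a > 0" using u by (cases "?a = 0") auto
  have "hyp_chart ((\<rho> / norm ?a) *\<^sub>R ?a) \<in> halfspace_of u"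
    using sub a \<rho> by auto
  then have "\<rho> / norm ?a * (norm ?a)\<^sup>2 \<le> sqrt (1 + \<rho>\<^sup>2) * ?s"
    using a by (simp add: halfspace_of_def Rep_hyp_chart lorentz_def dot_square_norm)
  then have le: "\<rho> * norm ?a \<le> sqrt (1 + \<rho>\<^sup>2) * ?s"
    using a by (simp add: power2_eq_square)
  have "sqrt (1 + \<rho>\<^sup>2) > 0" by (simp add: add_pos_nonneg)
  moreover have "0 \<le> \<rho> * norm ?a" using \<rho> by simp
  ultimately have s: "?s \<ge> 0" using le by (meson order_trans zero_le_mult_iff linorder_not_less)
  have "(\<rho> * norm ?a)\<^sup>2 \<le> (sqrt (1 + \<rho>\<^sup>2) * ?s)\<^sup>2"
    using le \<rho> by (intro power_mono) simp_all
  then have "\<rho>\<^sup>2 * (norm ?a)\<^sup>2 \<le> (1 + \<rho>\<^sup>2) * ?s\<^sup>2" by (simp add: power_mult_distrib)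
  then show ?thesis using s by (simp add: uu algebra_simps)
qed

text \<open>The midpoint of the long segment is at distance at least \<open>arsinh \<rho>\<close> from \<open>H\<close>, and on the side
  on which the segment does not approach \<open>H\<close> the Lorentz product with the normal is magnified by
  the factor \<open>cosh L\<close>.\<close>

lemma lassak_width_ge:
  fixes K :: "'n::finite hyp set"
  assumes K: "compact K" and H: "supporting_hyperplane K H"
    and ball: "hyp_chart ` cball 0 \<rho> \<subseteq> K" and e: "norm e = 1"
    and ends: "hyp_chart (sinh L *\<^sub>R e) \<in> K" "hyp_chart (- (sinh L *\<^sub>R e)) \<in> K"
    and \<rho>: "\<rho> \<ge> 0" and w: "0 \<le> w" "sinh w \<le> \<rho> * cosh L"
  shows "w \<le> lassak_width K H"
proof -
  obtain v where v: "lorentz v v > 0" "H = hyperplane_of v" "H \<inter> K \<noteq> {}"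
    and side: "K \<subseteq> halfspace_of v \<or> K \<subseteq> halfspace_of (- v)"
    using H unfolding supporting_hyperplane_def by blast
  have neg: "lorentz (- v) (- v) = lorentz v v" "hyperplane_of (- v) = hyperplane_of v"
    by (auto simp: lorentz_def hyperplane_of_def)
  obtain u where u: "lorentz u u > 0" "H = hyperplane_of u" "K \<subseteq> halfspace_of u"
    using side that[of v] that[of "- v"] v(1,2) neg by metis
  have s: "snd u \<ge> 0" "\<rho>\<^sup>2 * lorentz u u \<le> (snd u)\<^sup>2"
    using normal_of_ball[OF u(1) _ \<rho>] ball u(3) by blast+
  let ?p = "hyp_chart (sinh L *\<^sub>R e)" and ?q = "hyp_chart (- (sinh L *\<^sub>R e))"
  have p: "lorentz (Rep_hyp ?p) u = sinh L * (e \<bullet> fst u) - cosh L * snd u"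
    using Rep_hyp_chart_polar[OF e] by (simp add: lorentz_def)
  have q: "lorentz (Rep_hyp ?q) u = - sinh L * (e \<bullet> fst u) - cosh L * snd u"
    using Rep_hyp_chart_polar[of "- e" L] e by (simp add: lorentz_def)
  \<comment> \<open>The end point on whose side the segment does not approach \<open>H\<close>.\<close>
  obtain y where y: "y \<in> K" "lorentz (Rep_hyp y) u \<le> - (cosh L * snd u)"
    using ends p q by (cases "sinh L * (e \<bullet> fst u) \<le> 0") force+
  have "(sinh w)\<^sup>2 * lorentz u u \<le> (\<rho> * cosh L)\<^sup>2 * lorentz u u"
    using w u(1) by (intro mult_right_mono power_mono) auto
  also have "\<dots> = (cosh L)\<^sup>2 * (\<rho>\<^sup>2 * lorentz u u)" by (simp add: power_mult_distrib)
  also have "\<dots> \<le> (cosh L)\<^sup>2 * (snd u)\<^sup>2" using s by (intro mult_left_mono) auto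
  also have "\<dots> \<le> (lorentz (Rep_hyp y) u)\<^sup>2"
    using y(2) s(1) power_mono[of "cosh L * snd u" "- lorentz (Rep_hyp y) u" 2]
    by (simp add: power_mult_distrib)
  finally have "w \<le> infdist y H"
    using infdist_hyperplane_ge[OF u(1)] u(2) v(3) by blast
  also have "infdist y H \<le> lassak_width K H"
    unfolding lassak_width_def
  proof (rule cSUP_upper[OF y(1)])
    have "compact ((\<lambda>x. infdist x H) ` K)"
      by (intro compact_continuous_image K continuous_intros)
    then show "bdd_above ((\<lambda>x. infdist x H) ` K)"
      by (intro bounded_imp_bdd_above compact_imp_bounded)
  qed
  finally show ?thesis .
qed

section \<open>The spindle\<close>

definition off_axis :: "'n::finite \<Rightarrow> real^'n \<Rightarrow> real^'n" where
  "off_axis k x = x - (x $ k) *\<^sub>R axis k 1"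

lemma off_axis_nth: "off_axis k x $ i = (if i = k then 0 else x $ i)"
  by (simp add: off_axis_def axis_def)

lemma off_axis_add: "off_axis k (x + y) = off_axis k x + off_axis k y"
  and off_axis_scaleR: "off_axis k (c *\<^sub>R x) = c *\<^sub>R off_axis k x"
  and off_axis_axis: "off_axis k (axis k 1) = 0"
  by (simp_all add: vec_eq_iff off_axis_nth) (simp add: axis_def)

lemma norm_off_axis: "(norm x)\<^sup>2 = (x $ k)\<^sup>2 + (norm (off_axis k x))\<^sup>2"
proof -
  have "orthogonal ((x $ k) *\<^sub>R axis k 1) (off_axis k x)"
    by (simp add: orthogonal_def inner_axis' off_axis_nth)
  moreover have "(x $ k) *\<^sub>R axis k 1 + off_axis k x = x" by (simp add: off_axis_def)
  ultimately have "(norm x)\<^sup>2 = (norm ((x $ k) *\<^sub>R axis k (1::real)))\<^sup>2 + (norm (off_axis k x))\<^sup>2"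
    using norm_add_Pythagorean by metis
  then show ?thesis by simp
qed

lemma norm_off_axis_le: "norm (off_axis k x) \<le> norm x"
proof (rule power2_le_imp_le)
  show "(norm (off_axis k x))\<^sup>2 \<le> (norm x)\<^sup>2"
    unfolding norm_off_axis[of x k] using zero_le_power2[of "x $ k"] by linarith
qed simp

text \<open>The cone over the double cone \<open>|x'| + \<delta> |x\<^sub>k| \<le> \<delta> tanh L\<close> of the projective model, that is,
  the same inequality made homogeneous by the time coordinate. The number \<open>tanh L\<close> is the
  projective coordinate of the point at distance \<open>L\<close> from the origin on the axis.\<close>

definition spindle_cone :: "'n::finite \<Rightarrow> real \<Rightarrow> real \<Rightarrow> ((real^'n) \<times> real) set" where
  "spindle_cone k \<delta> L =
     {v. norm (off_axis k (fst v)) + \<delta> * \<bar>fst v $ k\<bar> \<le> \<delta> * tanh L * snd v}"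

definition spindle :: "'n::finite \<Rightarrow> real \<Rightarrow> real \<Rightarrow> 'n hyp set" where
  "spindle k \<delta> L = {p. Rep_hyp p \<in> spindle_cone k \<delta> L}"

lemma hyp_chart_in_spindle_iff:
  "hyp_chart x \<in> spindle k \<delta> L \<longleftrightarrow>
     norm (off_axis k x) + \<delta> * \<bar>x $ k\<bar> \<le> \<delta> * tanh L * sqrt (1 + (norm x)\<^sup>2)"
  by (simp add: spindle_def spindle_cone_def Rep_hyp_chart)

lemma geodesically_convex_spindle:
  assumes "\<delta> \<ge> 0"
  shows "geodesically_convex (spindle k \<delta> L)"
proof -
  have scale: "c *\<^sub>R x \<in> spindle_cone k \<delta> L" if "x \<in> spindle_cone k \<delta> L" "c \<ge> 0" for x c
  proof -
    have "c * (norm (off_axis k (fst x)) + \<delta> * \<bar>fst x $ k\<bar>) \<le> c * (\<delta> * tanh L * snd x)"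
      using that by (intro mult_left_mono) (auto simp: spindle_cone_def)
    then show ?thesis
      using that(2) by (simp add: spindle_cone_def off_axis_scaleR abs_mult distrib_left mult.left_commute)
  qed
  have add: "x + y \<in> spindle_cone k \<delta> L"
    if "x \<in> spindle_cone k \<delta> L" "y \<in> spindle_cone k \<delta> L" for x y
  proof -
    have "norm (off_axis k (fst x) + off_axis k (fst y))
        \<le> norm (off_axis k (fst x)) + norm (off_axis k (fst y))"
      by (rule norm_triangle_ineq)
    moreover have "\<delta> * \<bar>fst x $ k + fst y $ k\<bar> \<le> \<delta> * (\<bar>fst x $ k\<bar> + \<bar>fst y $ k\<bar>)"
      using assms by (intro mult_left_mono) auto
    ultimately show ?thesis using that
      unfolding spindle_cone_def mem_Collect_eq fst_add snd_add off_axis_add vector_add_component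
        distrib_left by linarith
  qed
  have "cone (spindle_cone k \<delta> L)" using scale by (simp add: cone_def)
  moreover from this have "convex (spindle_cone k \<delta> L)"
    using scale add by (auto simp: convex_def)
  ultimately show ?thesis
    unfolding spindle_def by (intro geodesically_convex_cone_section)
qed

text \<open>For \<open>\<delta> \<le> 1\<close> the tips are the points of the spindle farthest from the origin.\<close>

lemma norm_le_in_spindle:
  fixes x :: "real^'n::finite"
  assumes \<delta>: "0 < \<delta>" "\<delta> \<le> 1" and L: "0 < L" and x: "hyp_chart x \<in> spindle k \<delta> L"
  shows "norm x \<le> sinh L"
proof -
  define t where "t = sqrt (1 + (norm x)\<^sup>2)"
  have "t\<^sup>2 = 1 + (norm x)\<^sup>2" by (simp add: t_def)
  have "norm x \<le> norm (off_axis k x) + norm ((x $ k) *\<^sub>R (axis k 1 :: real^'n))"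
    using norm_triangle_ineq[of "off_axis k x" "(x $ k) *\<^sub>R axis k 1"] by (simp add: off_axis_def)
  then have "norm x \<le> norm (off_axis k x) + \<bar>x $ k\<bar>" by simp
  then have "\<delta> * norm x \<le> \<delta> * norm (off_axis k x) + \<delta> * \<bar>x $ k\<bar>"
    using \<delta> mult_left_mono[of "norm x" _ \<delta>] by (metis distrib_left less_imp_le)
  also have "\<dots> \<le> norm (off_axis k x) + \<delta> * \<bar>x $ k\<bar>"
    using \<delta> by (simp add: mult_left_le_one_le)
  also have "\<dots> \<le> \<delta> * (tanh L * t)"
    using x by (simp add: hyp_chart_in_spindle_iff t_def mult.assoc)
  finally have "norm x \<le> tanh L * t" using \<delta> by simp
  then have "cosh L * norm x \<le> sinh L * t" by (simp add: tanh_def field_simps)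
  then have "(cosh L * norm x)\<^sup>2 \<le> (sinh L * t)\<^sup>2" by (intro power_mono) simp_all
  then have "(norm x)\<^sup>2 \<le> (sinh L)\<^sup>2"
    unfolding power_mult_distrib \<open>t\<^sup>2 = _\<close> cosh_square_eq
    by (simp only: distrib_left distrib_right mult_1_left mult_1_right)
  then show ?thesis using L by - (rule power2_le_imp_le, simp_all)
qed

lemma compact_spindle:
  assumes \<delta>: "0 < \<delta>" "\<delta> \<le> 1" and L: "0 < L"
  shows "compact (spindle k \<delta> L)"
proof -
  let ?C = "hyp_chart -` spindle k \<delta> L"
  have "?C = {x. norm (off_axis k x) + \<delta> * \<bar>x $ k\<bar> \<le> \<delta> * tanh L * sqrt (1 + (norm x)\<^sup>2)}"
    by (auto simp: hyp_chart_in_spindle_iff)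
  moreover have "closed \<dots>"
    unfolding off_axis_def by (intro closed_Collect_le continuous_intros)
  moreover have "bounded ?C"
    using norm_le_in_spindle[OF \<delta> L] by (auto simp: bounded_iff)
  ultimately have "compact ?C" by (simp add: compact_eq_bounded_closed)
  then have "compact (hyp_chart ` ?C)"
    by (intro compact_continuous_image continuous_on_subset[OF continuous_hyp_chart]) auto
  then show ?thesis
    by (simp only: surj_image_vimage_eq[OF bij_is_surj[OF bij_hyp_chart]])
qed

lemma ball_subset_spindle:
  fixes k :: "'n::finite"
  assumes \<delta>: "0 < \<delta>" "\<delta> \<le> 1" and L: "0 < L"
  shows "hyp_chart ` cball 0 (\<delta> * tanh L / 2) \<subseteq> spindle k \<delta> L"
proof clarify
  fix x :: "real^'n" assume "x \<in> cball 0 (\<delta> * tanh L / 2)"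
  then have x: "norm x \<le> \<delta> * tanh L / 2" by simp
  have "\<delta> * \<bar>x $ k\<bar> \<le> norm x"
    using \<delta> mult_mono[of \<delta> 1 "\<bar>x $ k\<bar>" "norm x"] component_le_norm_cart[of x k] by simp
  then have "norm (off_axis k x) + \<delta> * \<bar>x $ k\<bar> \<le> \<delta> * tanh L * 1"
    using norm_off_axis_le[of k x] x by simp
  also have "\<dots> \<le> \<delta> * tanh L * sqrt (1 + (norm x)\<^sup>2)"
    using \<delta> L by (intro mult_left_mono) auto
  finally show "hyp_chart x \<in> spindle k \<delta> L" by (simp add: hyp_chart_in_spindle_iff)
qed

lemma hyp_ball_subset_chart_cball:
  assumes "0 \<le> r"
  shows "ball (hyp_chart 0) r \<subseteq> hyp_chart ` cball (0 :: real^'n::finite) (sinh r)"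
proof
  fix p :: "'n hyp" assume p: "p \<in> ball (hyp_chart 0) r"
  obtain x where x: "p = hyp_chart x" using bij_hyp_chart by (metis bij_pointE)
  have l: "- lorentz (Rep_hyp (hyp_chart 0)) (Rep_hyp p) = sqrt (1 + (norm x)\<^sup>2)"
    by (simp add: x Rep_hyp_chart lorentz_def)
  have "arcosh (sqrt (1 + (norm x)\<^sup>2)) < r"
    using p l by (simp add: dist_hyp_def)
  then have "cosh (arcosh (sqrt (1 + (norm x)\<^sup>2))) \<le> cosh r"
    using assms by (subst cosh_real_nonneg_le_iff) auto
  then have "sqrt (1 + (norm x)\<^sup>2) \<le> cosh r" by simp
  then have "1 + (norm x)\<^sup>2 \<le> (cosh r)\<^sup>2" by (simp add: sqrt_le_D)
  then have "norm x \<le> sinh r"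
    using assms by - (rule power2_le_imp_le, simp_all add: cosh_square_eq)
  then show "p \<in> hyp_chart ` cball 0 (sinh r)" by (simp add: x)
qed

lemma convex_body_spindle:
  assumes \<delta>: "0 < \<delta>" "\<delta> \<le> 1" and L: "0 < L"
  shows "convex_body (spindle k \<delta> L)"
proof -
  define r where "r = arsinh (\<delta> * tanh L / 2)"
  have r: "0 < r" "sinh r = \<delta> * tanh L / 2" using \<delta> L by (simp_all add: r_def)
  have "ball (hyp_chart 0) r \<subseteq> spindle k \<delta> L"
    using hyp_ball_subset_chart_cball[of r] r ball_subset_spindle[OF \<delta> L, of k] by force
  then have "hyp_chart 0 \<in> interior (spindle k \<delta> L)"
    using r by (auto simp: mem_interior)
  then show ?thesis
    using compact_spindle[OF assms] geodesically_convex_spindle[of \<delta>] \<delta>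
    by (auto simp: convex_body_def)
qed

lemma spindle_ends:
  assumes "\<bar>c\<bar> = 1" and "0 < L"
  shows "hyp_chart (sinh L *\<^sub>R (c *\<^sub>R axis k 1)) \<in> spindle k \<delta> L"
  using Rep_hyp_chart_polar[of "c *\<^sub>R axis k 1" L] assms
  by (simp add: spindle_def spindle_cone_def off_axis_scaleR off_axis_axis abs_mult tanh_def)

text \<open>The hyperplane orthogonal to the axis at a tip. An infimum over no supporting hyperplanes would
  carry no information, so one has to be exhibited.\<close>

lemma supporting_hyperplane_spindle:
  assumes \<delta>: "0 < \<delta>" and L: "0 < L"
  shows "supporting_hyperplane (spindle k \<delta> L) (hyperplane_of (cosh L *\<^sub>R axis k 1, sinh L))"
proof -
  let ?u = "(cosh L *\<^sub>R axis k 1 :: real^'a, sinh L)"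
  have "lorentz ?u ?u = 1"
    using cosh_square_eq[of L] by (simp add: lorentz_def inner_axis_axis power2_eq_square)
  moreover have "hyp_chart (sinh L *\<^sub>R axis k 1) \<in> hyperplane_of ?u \<inter> spindle k \<delta> L"
    using spindle_ends[of 1 L k \<delta>] L
    by (simp add: hyperplane_of_def Rep_hyp_chart_polar lorentz_def inner_axis_axis)
  moreover have "p \<in> halfspace_of ?u" if "p \<in> spindle k \<delta> L" for p
  proof -
    let ?x = "fst (Rep_hyp p)" and ?t = "snd (Rep_hyp p)"
    have "\<delta> * \<bar>?x $ k\<bar> \<le> \<delta> * (tanh L * ?t)"
      using that norm_ge_zero[of "off_axis k ?x"]
      unfolding spindle_def spindle_cone_def mem_Collect_eq by linarith
    then have "?x $ k \<le> tanh L * ?t" using \<delta> by simp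
    then have "cosh L * ?x $ k \<le> sinh L * ?t" by (simp add: tanh_def field_simps)
    then show ?thesis by (simp add: halfspace_of_def lorentz_def inner_axis mult.commute)
  qed
  ultimately show ?thesis unfolding supporting_hyperplane_def
    by (intro exI[of _ ?u]) auto
qed

lemma min_lassak_width_spindle:
  assumes \<delta>: "0 < \<delta>" "\<delta> \<le> 1" and L: "0 < L" and w: "0 \<le> w" "sinh w \<le> \<delta> * sinh L / 2"
  shows "w \<le> min_lassak_width (spindle k \<delta> L)"
  unfolding min_lassak_width_def
proof (rule cINF_greatest)
  show "{H. supporting_hyperplane (spindle k \<delta> L) H} \<noteq> {}"
    using supporting_hyperplane_spindle[OF \<delta>(1) L] by blast
next
  fix H assume "H \<in> {H. supporting_hyperplane (spindle k \<delta> L) H}"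
  then have H: "supporting_hyperplane (spindle k \<delta> L) H" by simp
  show "w \<le> lassak_width (spindle k \<delta> L) H"
  proof (rule lassak_width_ge[OF compact_spindle[OF \<delta> L] H ball_subset_spindle[OF \<delta> L],
        of "axis k 1" L w])
    show "sinh w \<le> \<delta> * tanh L / 2 * cosh L" using w by (simp add: tanh_def)
  qed (use spindle_ends[of 1 L k \<delta>] spindle_ends[of "-1" L k \<delta>] \<delta> L w in auto)
qed

section \<open>The volume of the spindle\<close>

text \<open>With \<open>y = |x'|\<close>, \<open>b = |x\<^sub>k|\<close> and \<open>t\<close> the time coordinate, the spindle satisfies
  \<open>y \<le> \<delta> (t - b)\<close>, and \<open>t - b = (1 + y\<^sup>2) / (t + b)\<close>. The term \<open>\<delta> y\<^sup>2\<close> is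
  absorbed by half of \<open>y t\<close>, since \<open>y \<le> t\<close>, and \<open>y\<close> decays like \<open>1 / t\<close> with a constant that does
  not involve \<open>L\<close>.\<close>

lemma off_axis_small_in_spindle:
  assumes \<delta>: "0 < \<delta>" "\<delta> \<le> 1/2" and x: "hyp_chart x \<in> spindle k \<delta> L"
  shows "norm (off_axis k x) * sqrt (1 + (norm x)\<^sup>2) \<le> 2 * \<delta>"
proof -
  define t y b where "t = sqrt (1 + (norm x)\<^sup>2)" and "y = norm (off_axis k x)" and "b = \<bar>x $ k\<bar>"
  have pos: "t \<ge> 0" "y \<ge> 0" "b \<ge> 0" by (simp_all add: t_def y_def b_def)
  have t: "t\<^sup>2 = 1 + b\<^sup>2 + y\<^sup>2"
    using norm_off_axis[of x k] by (simp add: t_def y_def b_def)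
  have "y + \<delta> * b \<le> \<delta> * tanh L * t"
    using x by (simp add: hyp_chart_in_spindle_iff t_def y_def b_def)
  also have "\<dots> \<le> \<delta> * 1 * t"
    using \<delta> pos tanh_real_lt_1[of L] by (intro mult_right_mono mult_left_mono) auto
  finally have "y \<le> \<delta> * (t - b)" by (simp add: algebra_simps)
  then have "y * (t + b) \<le> \<delta> * (t - b) * (t + b)"
    using pos by (intro mult_right_mono) auto
  also have "\<dots> = \<delta> * (1 + y\<^sup>2)"
    using t by (simp add: power2_eq_square algebra_simps)
  finally have 1: "y * t + y * b \<le> \<delta> + \<delta> * y\<^sup>2" by (simp add: algebra_simps)
  have "y \<le> t" using t pos by - (rule power2_le_imp_le, auto)
  then have "\<delta> * y\<^sup>2 \<le> 1/2 * (y * t)"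
    using \<delta> pos unfolding power2_eq_square by (intro mult_mono) auto
  moreover have "y * b \<ge> 0" using pos by simp
  ultimately have "y * t \<le> 2 * \<delta>" using 1 by linarith
  then show ?thesis by (simp add: t_def y_def)
qed

lemma emeasure_axis_box:
  fixes k :: "'n::finite"
  assumes "0 \<le> a" "0 \<le> b"
  shows "emeasure lborel {x :: real^'n. \<bar>x $ k\<bar> \<le> a \<and> (\<forall>i. i \<noteq> k \<longrightarrow> \<bar>x $ i\<bar> \<le> b)}
    = ennreal (2 * a * (2 * b) ^ (CARD('n) - 1))"
proof -
  define c :: "real^'n" where "c = (\<chi> i. if i = k then a else b)"
  have box: "{x :: real^'n. \<bar>x $ k\<bar> \<le> a \<and> (\<forall>i. i \<noteq> k \<longrightarrow> \<bar>x $ i\<bar> \<le> b)} = cbox (- c) c"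
    by (force simp: c_def mem_box_cart abs_le_iff split: if_splits)
  have ne: "cbox (- c) c \<noteq> {}"
    using assms by (auto simp: c_def interval_ne_empty_cart)
  have "measure lborel (cbox (- c) c) = (\<Prod>i\<in>UNIV. c $ i - (- c) $ i)"
    by (rule content_cbox_cart[OF ne])
  also have "\<dots> = (c $ k - (- c) $ k) * (\<Prod>i\<in>UNIV - {k}. c $ i - (- c) $ i)"
    by (simp add: prod.remove)
  also have "(\<Prod>i\<in>UNIV - {k}. c $ i - (- c) $ i) = (\<Prod>i\<in>UNIV - {k}. 2 * b)"
    by (intro prod.cong) (auto simp: c_def)
  finally have "measure lborel (cbox (- c) c) = 2 * a * (2 * b) ^ (CARD('n) - 1)"
    by (simp add: c_def card_Diff_singleton)
  then show ?thesis
    unfolding box using emeasure_lborel_cbox_finite[of "- c" c]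
    by (subst emeasure_eq_ennreal_measure) auto
qed

lemma ex_dyadic_shell:
  fixes t :: real
  assumes "1 \<le> t"
  obtains j :: nat where "2 ^ j \<le> t" "t \<le> 2 ^ Suc j"
proof
  define j where "j = nat \<lfloor>log 2 t\<rfloor>"
  have "log 2 t \<ge> 0" using assms by simp
  then have j: "real j \<le> log 2 t" "log 2 t \<le> real (Suc j)" unfolding j_def by linarith+
  then show "2 ^ j \<le> t" using assms by (simp add: le_log_iff powr_realpow)
  have "t \<le> 2 powr real (Suc j)" using j(2) assms by (subst (asm) log_le_iff) auto
  also have "\<dots> = 2 ^ Suc j" by (rule powr_realpow) simp
  finally show "t \<le> 2 ^ Suc j" .
qed

text \<open>Cut the spindle into the shells \<open>2\<^sup>j \<le> t \<le> 2\<^sup>j\<^sup>+\<^sup>1\<close>. Such a shell lies in a box of length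
  \<open>4 2\<^sup>j\<close> and of width \<open>4 \<delta> / 2\<^sup>j\<close> in each of the other directions, of which there is at least one,
  and the density is at most \<open>1 / 2\<^sup>j\<close>. So its volume is at most \<open>16 \<delta> / 2\<^sup>j\<close>, and the geometric
  series sums to \<open>32 \<delta>\<close>.\<close>

lemma hyp_volume_spindle:
  fixes k :: "'n::finite"
  assumes n: "CARD('n) \<ge> 2" and \<delta>: "0 < \<delta>" "\<delta> \<le> 1/4" and L: "0 < L"
  shows "hyp_volume (spindle k \<delta> L) \<le> ennreal (32 * \<delta>)"
proof -
  define f :: "real^'n \<Rightarrow> ennreal" where "f = (\<lambda>x. ennreal (1 / sqrt (1 + (norm x)\<^sup>2)))"
  have f[measurable]: "f \<in> borel_measurable borel" unfolding f_def by measurable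
  let ?M = "density lborel f"
  have K: "spindle k \<delta> L \<in> sets borel"
    using compact_spindle[of \<delta> L k] \<delta> L by (simp add: borel_compact)
  define R :: "(real^'n) set" where "R = hyp_chart -` spindle k \<delta> L"
  have chart: "hyp_chart \<in> borel_measurable (borel :: (real^'n) measure)"
    by (rule borel_measurable_continuous_onI[OF continuous_hyp_chart])
  have R[measurable]: "R \<in> sets borel"
    using measurable_sets[OF chart K] by (simp add: R_def)
  define S :: "nat \<Rightarrow> (real^'n) set" where
    "S j = R \<inter> {x. 2 ^ j \<le> sqrt (1 + (norm x)\<^sup>2) \<and> sqrt (1 + (norm x)\<^sup>2) \<le> 2 ^ Suc j}" for j
  have S[measurable]: "S j \<in> sets borel" for j unfolding S_def by measurable
  have cover: "R \<subseteq> (\<Union>j. S j)"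
  proof
    fix x assume x: "x \<in> R"
    have "1 \<le> sqrt (1 + (norm x)\<^sup>2)" by simp
    then obtain j where "2 ^ j \<le> sqrt (1 + (norm x)\<^sup>2)" "sqrt (1 + (norm x)\<^sup>2) \<le> 2 ^ Suc j"
      by (rule ex_dyadic_shell)
    then show "x \<in> (\<Union>j. S j)" using x by (auto simp: S_def)
  qed
  have shell: "emeasure ?M (S j) \<le> ennreal (16 * \<delta> * (1/2) ^ j)" for j
  proof -
    define B where
      "B = {x :: real^'n. \<bar>x $ k\<bar> \<le> 2 ^ Suc j \<and> (\<forall>i. i \<noteq> k \<longrightarrow> \<bar>x $ i\<bar> \<le> 2 * \<delta> / 2 ^ j)}"
    have "S j \<subseteq> B"
    proof
      fix x assume x: "x \<in> S j"
      define t where "t = sqrt (1 + (norm x)\<^sup>2)"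
      have t: "2 ^ j \<le> t" "t \<le> 2 ^ Suc j" and xR: "hyp_chart x \<in> spindle k \<delta> L"
        using x by (auto simp: S_def R_def t_def)
      have "norm x \<le> t" by (simp add: t_def real_le_rsqrt)
      then have "\<bar>x $ k\<bar> \<le> 2 ^ Suc j" using component_le_norm_cart[of x k] t by linarith
      moreover have "\<bar>x $ i\<bar> \<le> 2 * \<delta> / 2 ^ j" if "i \<noteq> k" for i
      proof -
        have "\<bar>x $ i\<bar> * 2 ^ j \<le> norm (off_axis k x) * t"
          using component_le_norm_cart[of "off_axis k x" i] that t
          by (intro mult_mono) (auto simp: off_axis_nth)
        also have "\<dots> \<le> 2 * \<delta>"
          unfolding t_def using off_axis_small_in_spindle[OF _ _ xR] \<delta> by simp
        finally show ?thesis by (simp add: field_simps)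
      qed
      ultimately show "x \<in> B" by (simp add: B_def)
    qed
    moreover have "closed B" unfolding B_def
      by (intro closed_Collect_conj closed_Collect_all closed_Collect_imp closed_Collect_le
          continuous_intros) auto
    ultimately have SB: "emeasure lborel (S j) \<le> emeasure lborel B"
      by (intro emeasure_mono) auto
    have "emeasure ?M (S j) = (\<integral>\<^sup>+x. f x * indicator (S j) x \<partial>lborel)"
      by (simp add: emeasure_density)
    also have "\<dots> \<le> (\<integral>\<^sup>+x. ennreal (1 / 2 ^ j) * indicator (S j) x \<partial>lborel)"
      by (intro nn_integral_mono)
        (auto simp: f_def S_def indicator_def
          intro!: ennreal_leI divide_left_mono mult_pos_pos add_pos_nonneg)
    also have "\<dots> = ennreal (1 / 2 ^ j) * emeasure lborel (S j)"
      by (simp add: nn_integral_cmult_indicator)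
    also have "\<dots> \<le> ennreal (1 / 2 ^ j) * emeasure lborel B"
      using SB by (rule mult_left_mono) simp
    also have "\<dots> = ennreal (1 / 2 ^ j * (2 * 2 ^ Suc j * (2 * (2 * \<delta> / 2 ^ j)) ^ (CARD('n) - 1)))"
      unfolding B_def using \<delta> by (simp only: emeasure_axis_box ennreal_mult'[symmetric]
        zero_le_divide_iff zero_le_power zero_le_numeral zero_le_one mult_nonneg_nonneg less_imp_le simp_thms)
    \<comment> \<open>The width \<open>4 \<delta> / 2\<^sup>j\<close> is at most \<open>1\<close> because \<open>\<delta> \<le> 1/4\<close>, so all but one of the factors
      can be dropped.\<close>
    also have "\<dots> \<le> ennreal (1 / 2 ^ j * (2 * 2 ^ Suc j * (2 * (2 * \<delta> / 2 ^ j))))"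
    proof (intro ennreal_leI mult_left_mono)
      have "4 * \<delta> \<le> 2 ^ j" using \<delta> one_le_power[of "2::real" j] by linarith
      then have "2 * (2 * \<delta> / 2 ^ j) \<le> 1" by (simp add: field_simps)
      then show "(2 * (2 * \<delta> / 2 ^ j)) ^ (CARD('n) - 1) \<le> 2 * (2 * \<delta> / 2 ^ j)"
        using power_decreasing[of 1 "CARD('n) - 1" "2 * (2 * \<delta> / 2 ^ j)"] n \<delta> by simp
    qed auto
    also have "1 / 2 ^ j * (2 * 2 ^ Suc j * (2 * (2 * \<delta> / 2 ^ j))) = 16 * \<delta> * (1/2) ^ j"
      by (simp add: field_simps)
    finally show ?thesis .
  qed
  have "hyp_volume (spindle k \<delta> L) = emeasure ?M R"
    unfolding hyp_volume_eq[OF K] by (simp add: R_def[symmetric] f_def emeasure_density)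
  also have "\<dots> \<le> emeasure ?M (\<Union>j. S j)"
    using cover by (intro emeasure_mono) auto
  also have "\<dots> \<le> (\<Sum>j. emeasure ?M (S j))"
    by (intro emeasure_subadditive_countably) auto
  also have "\<dots> \<le> (\<Sum>j. ennreal (16 * \<delta> * (1/2) ^ j))"
    by (intro suminf_le shell) auto
  also have "\<dots> = ennreal (32 * \<delta>)"
  proof -
    have "(\<lambda>j. 16 * \<delta> * (1/2) ^ j) sums (16 * \<delta> * (1 / (1 - 1/2)))"
      by (intro sums_mult geometric_sums) simp
    then show ?thesis
      using \<delta> by (intro suminf_ennreal_eq) auto
  qed
  finally show ?thesis .
qed

section \<open>Bodies of large width and small volume\<close>

theorem theorem1p2:
  fixes w :: real
  assumes "w > 0" and "CARD('n::finite) \<ge> 2"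
  shows "Inf {hyp_volume K | K :: 'n hyp set. convex_body K \<and> min_lassak_width K \<ge> w} = 0"
    (is "Inf ?V = 0")
proof -
  have "Inf ?V \<le> 0"
  proof (rule ennreal_le_epsilon)
    fix \<epsilon> :: real assume \<epsilon>: "0 < \<epsilon>"
    define \<delta> where "\<delta> = min (1/4) (\<epsilon> / 32)"
    have \<delta>: "0 < \<delta>" "\<delta> \<le> 1/4" "32 * \<delta> \<le> \<epsilon>" using \<epsilon> by (auto simp: \<delta>_def)
    \<comment> \<open>Chosen so that \<open>cosh L sinh r = sinh w\<close> for the inner ball, whose radius \<open>r\<close> satisfies
      \<open>sinh r = \<delta> tanh L / 2\<close>.\<close>
    define L where "L = arsinh (2 * sinh w / \<delta>)"
    have L: "0 < L" "sinh w \<le> \<delta> * sinh L / 2" using \<delta> assms(1) by (simp_all add: L_def)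
    obtain k :: 'n where True by simp
    let ?K = "spindle k \<delta> L"
    have "convex_body ?K" using convex_body_spindle[of \<delta> L k] \<delta> L by simp
    moreover have "w \<le> min_lassak_width ?K"
      using min_lassak_width_spindle[of \<delta> L w k] \<delta> L assms(1) by simp
    ultimately have "Inf ?V \<le> hyp_volume ?K" by (intro Inf_lower) blast
    also have "\<dots> \<le> ennreal (32 * \<delta>)"
      by (rule hyp_volume_spindle[OF assms(2) \<delta>(1,2) L(1)])
    also have "\<dots> \<le> 0 + ennreal \<epsilon>" using \<delta>(3) by (simp add: ennreal_leI)
    finally show "Inf ?V \<le> 0 + ennreal \<epsilon>" .
  qed
  then show ?thesis by simp
qed

end
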